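(* There is an absolute constant $x_0$ such that the following holds. Let $x\ge x_0$ be real, let $q,b$ be integers with $x>q>b>0$ and $\gcd(b,q)=1$, and let $0\le\delta\le1$. Suppose that $\pi(x;q,b)\le \frac{\delta x}{\phi(q)}$. Let $u$ be the smallest integer satisfying both $u>2\sqrt{x}$ and $\frac{u}{\log u}\ge \frac{10\delta x}{q}$. Then \[ G(e^{2u})\ \ge\ J(u)\ \ge\ \frac{x-b}{q}. \]
   Context: For real $x$, $G(x)$ denotes the largest gap between consecutive primes less than (or equal to) $x$. For $u\ge 1$, $J(u)$ (Jacobsthal's function) denotes the maximum gap between consecutive integers having no prime factor $p\le u$. $\pi(x;q,b)$ is the number of primes $p\le x$ with $p\equiv b\pmod q$, $\phi$ is Euler's totient function, and $\log$ is the natural logarithm. *)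

theory Defs
  imports Complex_Main "HOL-Number_Theory.Number_Theory"
begin

definition consecutive_in :: "int set \<Rightarrow> int \<Rightarrow> int \<Rightarrow> bool" where
  "consecutive_in S a b \<longleftrightarrow> a \<in> S \<and> b \<in> S \<and> a < b \<and> S \<inter> {a<..<b} = {}"

definition max_gap :: "int set \<Rightarrow> int" where
  "max_gap S = Max {b - a | a b. consecutive_in S a b}"

text \<open>
  Both primes bounding a gap are required to be at most \<open>x\<close>.
  The set of gaps is finite, and it is nonempty for \<open>x \<ge> 3\<close>.
\<close>

definition prime_gap :: "real \<Rightarrow> int" where
  "prime_gap x = max_gap {p. prime p \<and> real_of_int p \<le> x}"

text \<open>
  The sifted set is periodic modulo the product of the primes up to \<open>u\<close> and
  contains \<open>1\<close>, so its gaps form a finite nonempty set and \<open>Max\<close> is meaningful.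
\<close>

definition jacobsthal :: "real \<Rightarrow> int" where
  "jacobsthal u = max_gap {n. \<not> (\<exists>p. prime p \<and> real_of_int p \<le> u \<and> p dvd n)}"

definition prime_count_ap :: "real \<Rightarrow> int \<Rightarrow> int \<Rightarrow> nat" where
  "prime_count_ap x q b = card {p :: int. prime p \<and> real_of_int p \<le> x \<and> [p = b] (mod q)}"

end

theory Submission
  imports Defs "HOL-Real_Asymp.Real_Asymp" "HOL-Analysis.Harmonic_Numbers"
begin

text \<open>
  For the lower bound on \<open>J(u)\<close>, sieve the integers \<open>0 \<le> m \<le> (x - b) / q\<close> by one residue class
  modulo each prime \<open>p \<le> u\<close>. For \<open>p \<le> \<surd>x\<close> not dividing \<open>q\<close>, use the class on which
  \<open>p\<close> divides \<open>q m + b\<close>; what survives is at most \<open>\<pi>(x; q, b) + 1\<close> integers \<open>m\<close>. For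
  \<open>p \<le> \<surd>x\<close> dividing \<open>q\<close>, choose the class greedily, which multiplies the number of
  survivors by about \<open>\<phi>(q) / q\<close> (at most one prime factor of \<open>q\<close> exceeds \<open>\<surd>x\<close>, so at most a
  factor 2 is lost). At most \<open>2 \<delta> x / q + 2 \<le> u / (5 log u) + 2\<close> integers remain, fewer than the
  primes in \<open>(\<surd>x, u]\<close>, and each is removed by a prime of its own.

  The number of primes in \<open>(n, 2n]\<close> is bounded below as in the proof by Erdos of Bertrand's postulate,
  by factoring the central binomial coefficient; this gives \<open>4/9 * n / log (2n)\<close> up to lower order,
  and \<open>2/5\<close> in place of \<open>4/9\<close> is what is needed.

  For \<open>G(exp(2u)) \<ge> J(u)\<close>, let \<open>Q \<le> 4^u\<close> be the product of the primes up to \<open>u\<close>. A maximal gap of the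
  sifted set, translated so that it starts in \<open>[Q, 2Q)\<close>, contains no primes in its interior, and
  it is followed by a prime at most \<open>6 * 4^u \<le> exp(2u)\<close>.
\<close>

subsection \<open>Primes between n and 2n\<close>

lemma multiplicity_eq_card_powers:
  fixes p m K :: nat
  assumes p: "prime p" and m: "m > 0" "m < p ^ K"
  shows "multiplicity p m = card {k \<in> {1..K}. p ^ k dvd m}"
proof -
  have dvd_iff: "p ^ k dvd m \<longleftrightarrow> k \<le> multiplicity p m" for k
    using p m by (intro power_dvd_iff_le_multiplicity) auto
  have "p ^ multiplicity p m \<le> m"
    using m by (intro dvd_imp_le multiplicity_dvd) auto
  hence "multiplicity p m < K"
    using m p by (metis le_less_trans power_less_imp_less_exp prime_gt_1_nat)
  hence "{k \<in> {1..K}. p ^ k dvd m} = {1..multiplicity p m}"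
    by (auto simp: dvd_iff)
  thus ?thesis by simp
qed

text \<open>Legendre's formula. Passing from \<open>n\<close> to \<open>Suc n\<close> raises
  \<open>n div p ^ k\<close> by one exactly when \<open>p ^ k\<close> divides \<open>Suc n\<close>.
  Cutting the sum at \<open>K\<close> loses nothing, because \<open>p ^ K\<close> exceeds
  \<open>n\<close>.\<close>

lemma multiplicity_fact:
  fixes p n K :: nat
  assumes p: "prime p" and "n < p ^ K"
  shows "multiplicity p (fact n) = (\<Sum>k=1..K. n div p ^ k)"
  using assms(2)
proof (induction n)
  case (Suc n)
  have "multiplicity p (fact (Suc n)) = multiplicity p (Suc n) + multiplicity p (fact n)"
    using p by (simp add: prime_elem_multiplicity_mult_distrib del: mult_Suc)
  also have "multiplicity p (Suc n) = (\<Sum>k=1..K. if p ^ k dvd Suc n then 1 else 0)"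
    using multiplicity_eq_card_powers[OF p _ Suc.prems] by (simp add: sum.If_cases Int_def)
  also have "\<dots> + multiplicity p (fact n) =
      (\<Sum>k=1..K. (if p ^ k dvd Suc n then 1 else 0) + n div p ^ k)"
    using Suc by (simp add: sum.distrib)
  also have "\<dots> = (\<Sum>k=1..K. Suc n div p ^ k)"
    by (intro sum.cong) (auto simp: div_Suc dvd_eq_mod_eq_0)
  finally show ?case .
qed simp

lemma multiplicity_central_binomial:
  fixes p n K :: nat
  assumes p: "prime p" and "2 * n < p ^ K"
  shows "multiplicity p (2 * n choose n) = (\<Sum>k=1..K. 2 * n div p ^ k - 2 * (n div p ^ k))"
proof -
  \<comment> \<open>This makes every truncated subtraction on the naturals below a genuine
    one.\<close>
  have *: "2 * (n div d) \<le> 2 * n div d" for d :: nat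
    by (cases "d = 0") (simp_all add: less_eq_div_iff_mult_less_eq mult.assoc)
  have "fact n * fact n * (2 * n choose n) = (fact (2 * n) :: nat)"
    using binomial_fact_lemma[of n "2 * n"] by (simp add: mult_2)
  hence "multiplicity p (fact (2 * n)) =
      multiplicity p (fact n) + multiplicity p (fact n) + multiplicity p (2 * n choose n)"
    using p by (metis prime_elem_multiplicity_mult_distrib prime_imp_prime_elem fact_nonzero
        mult_eq_0_iff)
  hence "multiplicity p (2 * n choose n) =
      (\<Sum>k=1..K. 2 * n div p ^ k) - 2 * (\<Sum>k=1..K. n div p ^ k)"
    using multiplicity_fact[OF p assms(2)] multiplicity_fact[OF p, of n K] assms(2) by simp
  also have "\<dots> = (\<Sum>k=1..K. 2 * n div p ^ k - 2 * (n div p ^ k))"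
    unfolding sum_distrib_left using * by (subst sum_subtractf_nat) auto
  finally show ?thesis .
qed

text \<open>In the sum for the multiplicity each term is 0 or 1, and it is 0 once
  \<open>p ^ k\<close> exceeds \<open>2 * n\<close>. So the multiplicity is at most the largest
  \<open>L\<close> with \<open>p ^ L \<le> 2 * n\<close>.\<close>

lemma prime_power_central_binomial_le:
  fixes p n :: nat
  assumes p: "prime p" and n: "n > 0"
  shows "p ^ multiplicity p (2 * n choose n) \<le> 2 * n"
proof -
  define K where "K = 2 * n"
  have p1: "p > 1" using p by (rule prime_gt_1_nat)
  have K: "2 * n < p ^ K"
    unfolding K_def using power_gt_expt[of p "2 * n"] p1 by simp
  define L where "L = Max {k. p ^ k \<le> 2 * n}"
  have sub: "{k. p ^ k \<le> 2 * n} \<subseteq> {..K}"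
  proof safe
    fix k assume "p ^ k \<le> 2 * n"
    hence "p ^ k < p ^ K" using K by (rule order.strict_trans1)
    hence "k < K" using p1 by (rule power_less_imp_less_exp[rotated])
    thus "k \<le> K" by simp
  qed
  hence fin: "finite {k. p ^ k \<le> 2 * n}" by (rule finite_subset) auto
  have "L \<in> {k. p ^ k \<le> 2 * n}"
    unfolding L_def by (rule Max_in[OF fin]) (use n in \<open>auto intro!: exI[of _ 0]\<close>)
  hence L: "p ^ L \<le> 2 * n" by simp
  have term_le: "2 * n div p ^ k - 2 * (n div p ^ k) \<le> (if k \<le> L then 1 else 0)" for k
  proof (cases "p ^ k \<le> 2 * n")
    case True
    hence "k \<le> L" unfolding L_def using fin by auto
    have "n < n div p ^ k * p ^ k + p ^ k"
      using p1 dividend_less_div_times[of "p ^ k" n] by simp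
    hence "2 * n div p ^ k < 2 * Suc (n div p ^ k)"
      by (intro less_mult_imp_div_less) (simp add: algebra_simps)
    with \<open>k \<le> L\<close> show ?thesis by simp
  qed simp
  have "multiplicity p (2 * n choose n) \<le> (\<Sum>k=1..K. if k \<le> L then 1 else 0)"
    unfolding multiplicity_central_binomial[OF p K] by (intro sum_mono term_le)
  also have "\<dots> = card {k \<in> {1..K}. k \<le> L}"
    by (simp add: sum.If_cases Int_def)
  also have "\<dots> \<le> card {1..L}" by (intro card_mono) auto
  finally have "multiplicity p (2 * n choose n) \<le> L" by simp
  thus ?thesis using L p1 by (meson less_imp_le power_increasing order_trans)
qed

text \<open>Primes in \<open>(2n/3, n]\<close> drop out: \<open>p\<close> occurs twice in the
  numerator \<open>(2n)!\<close> and once in each of the two factors \<open>n!\<close> of the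
  denominator.\<close>

lemma multiplicity_central_binomial_eq_0:
  fixes p n :: nat
  assumes p: "prime p" and n: "n \<ge> 5" and le: "p \<le> n" and gt: "2 * n < 3 * p"
  shows "multiplicity p (2 * n choose n) = 0"
proof -
  \<comment> \<open>From \<open>2 * n \<ge> 10\<close> and \<open>3 * p > 2 * n\<close> one gets
    \<open>9 * p^2 > 20 * n\<close>, so \<open>p^2 > 2 * n\<close> and only \<open>k = 1\<close> can
    contribute to the sum.\<close>
  have "(2 * n) * 10 \<le> (2 * n) * (2 * n)" using n by (intro mult_le_mono2) simp
  also have "\<dots> < (3 * p) * (3 * p)" by (rule mult_strict_mono) (use gt in auto)
  finally have sq: "2 * n < p ^ 2" by (simp add: power2_eq_square)
  have "2 * n div p = 2" using le gt by (intro div_nat_eqI) simp_all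
  moreover have "n div p = 1" using le gt n by (intro div_nat_eqI) simp_all
  ultimately show ?thesis
    unfolding multiplicity_central_binomial[OF p sq] using sq by (simp add: numeral_2_eq_2)
qed

section \<open>An upper bound for the product of the primes up to n\<close>

lemma prod_primes_dvd:
  fixes A :: "nat set"
  assumes "finite A" "\<And>p. p \<in> A \<Longrightarrow> prime p" "\<And>p. p \<in> A \<Longrightarrow> p dvd m"
  shows "\<Prod>A dvd m"
  using assms
proof (induction A rule: finite_induct)
  case (insert p A)
  have "coprime p (\<Prod>A)"
    using insert by (intro prod_coprime_right primes_coprime) auto
  thus ?case using insert by (simp add: divides_mult)
qed simp

definition primorial :: "nat \<Rightarrow> nat" where
  "primorial n = \<Prod>{p. prime p \<and> p \<le> n}"

lemma primorial_pos: "primorial n > 0"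
  unfolding primorial_def by (auto intro!: prod_pos prime_gt_0_nat)

text \<open>The row \<open>2 * k + 1\<close> has two equal middle entries, so twice one of them is
  at most the row sum \<open>2 ^ (2 * k + 1)\<close>.\<close>

lemma binomial_odd_le: "(2 * k + 1) choose k \<le> 4 ^ k"
proof -
  have "2 * ((2 * k + 1) choose k) = ((2 * k + 1) choose k) + ((2 * k + 1) choose (k + 1))"
    using binomial_symmetric[of k "2 * k + 1"] by simp
  also have "\<dots> = (\<Sum>i\<in>{k, k + 1}. (2 * k + 1) choose i)" by simp
  also have "\<dots> \<le> (\<Sum>i\<le>2 * k + 1. (2 * k + 1) choose i)"
    by (intro sum_mono2) auto
  also have "\<dots> = 2 ^ (2 * k + 1)" by (rule choose_row_sum)
  finally show ?thesis by (simp add: power_mult)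
qed

text \<open>Erdos' induction. An even \<open>n > 2\<close> adds no prime. For
  \<open>n = 2 * k + 1\<close> the primes up to \<open>k + 1\<close> are handled by induction, and
  the product of those in \<open>(k + 1, n]\<close> divides \<open>n choose k\<close>, which is at
  most \<open>4 ^ k\<close>.\<close>

lemma primorial_le: "primorial n \<le> 4 ^ n"
proof (induction n rule: less_induct)
  case (less n)
  consider "n \<le> 1" | "n = 2" | "n > 2" "even n" | "n > 2" "odd n" by linarith
  thus ?case
  proof cases
    case 1
    hence no: "{p::nat. prime p \<and> p \<le> n} = {}" using prime_gt_1_nat by (auto simp: not_le intro: le_less_trans)
    show ?thesis unfolding primorial_def no by simp
  next
    case 2
    have two: "{p::nat. prime p \<and> p \<le> 2} = {2}"
      using prime_ge_2_nat by (auto intro: antisym)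
    show ?thesis unfolding primorial_def 2 two by simp
  next
    case 3
    have "\<not> prime n" using 3 using prime_odd_nat by blast
    hence "p \<le> n \<longleftrightarrow> p \<le> n - 1" if "prime p" for p
      using that by (cases "p = n") auto
    hence "{p. prime p \<and> p \<le> n} = {p. prime p \<and> p \<le> n - 1}" by auto
    hence "primorial n \<le> 4 ^ (n - 1)" using less.IH[of "n - 1"] 3 by (simp add: primorial_def)
    also have "\<dots> \<le> 4 ^ n" by (intro power_increasing) auto
    finally show ?thesis .
  next
    case 4
    then obtain k where k: "n = 2 * k + 1" by (auto elim: oddE)
    have "{p. prime p \<and> p \<le> n} = {p. prime p \<and> p \<le> k + 1} \<union> {p. prime p \<and> k + 1 < p \<and> p \<le> n}"
      using k by auto
    hence "primorial n = primorial (k + 1) * \<Prod>{p. prime p \<and> k + 1 < p \<and> p \<le> n}"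
      unfolding primorial_def by (subst prod.union_disjoint [symmetric]) auto
    moreover have "primorial (k + 1) \<le> 4 ^ (k + 1)" using less.IH[of "k + 1"] k 4 by simp
    moreover have "\<Prod>{p. prime p \<and> k + 1 < p \<and> p \<le> n} dvd n choose k"
    proof (rule prod_primes_dvd)
      fix p assume "p \<in> {p. prime p \<and> k + 1 < p \<and> p \<le> n}"
      hence p: "prime p" "k + 1 < p" "p \<le> n" by auto
      have "fact k * fact (n - k) * (n choose k) = (fact n :: nat)"
        using k by (intro binomial_fact_lemma) auto
      moreover have "p dvd fact n" using p by (simp add: prime_dvd_fact_iff)
      \<comment> \<open>Here \<open>n - k = k + 1 < p\<close>.\<close>
      moreover have "\<not> p dvd fact k" "\<not> p dvd fact (n - k)"
        using p k by (auto simp: prime_dvd_fact_iff simp del: fact_Suc)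
      ultimately show "p dvd n choose k" using p(1) by (metis prime_dvd_mult_iff)
    qed auto
    hence "\<Prod>{p. prime p \<and> k + 1 < p \<and> p \<le> n} \<le> n choose k"
      using k by (intro dvd_imp_le) auto
    hence "\<Prod>{p. prime p \<and> k + 1 < p \<and> p \<le> n} \<le> 4 ^ k"
      using binomial_odd_le[of k] k by simp
    ultimately have "primorial n \<le> 4 ^ (k + 1) * 4 ^ k" by (simp add: mult_le_mono)
    also have "\<dots> = 4 ^ n" using k by (simp add: power_add[symmetric] mult_2)
    finally show ?thesis .
  qed
qed

section \<open>A lower bound for the number of primes between n and 2n\<close>

lemma central_binomial_le_prod:
  fixes n :: nat
  assumes n: "n \<ge> 5"
  shows "2 * n choose n \<le>
    (2 * n) ^ card {p. prime p \<and> p\<^sup>2 \<le> 2 * n} * 4 ^ (2 * n div 3) * (2 * n) ^ card {p. prime p \<and> n < p \<and> p \<le> 2 * n}"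
proof -
  define v where "v p = multiplicity p (2 * n choose n)" for p
  define A where "A = {p. prime p \<and> p\<^sup>2 \<le> 2 * n}"
  define B where "B = {p. prime p \<and> p \<le> 2 * n div 3}"
  define D where "D = {p. prime p \<and> n < p \<and> p \<le> 2 * n}"
  have fin: "finite B" "finite D" unfolding B_def D_def by auto
  have "A \<subseteq> {..2 * n}"
    unfolding A_def by (auto intro: power2_nat_le_imp_le)
  hence finA: "finite A" by (rule finite_subset) auto
  have pow: "p ^ v p \<le> 2 * n" if "prime p" for p
    unfolding v_def using prime_power_central_binomial_le[OF that] n by simp
  have v1: "v p \<le> 1" if "prime p" "p \<notin> A" for p
  proof (rule ccontr)
    assume "\<not> v p \<le> 1"
    hence "p ^ 2 \<le> p ^ v p" using that prime_gt_0_nat[of p] by (intro power_increasing) auto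
    also have "\<dots> \<le> 2 * n" using that by (intro pow)
    finally show False using that by (simp add: A_def)
  qed
  \<comment> \<open>No prime factor outside \<open>A\<close> lies in \<open>(2n/3, n]\<close>.
    Factors from \<open>A\<close> and \<open>D\<close> contribute at most \<open>2 * n\<close> each;
    those in \<open>B - A\<close> have exponent at most one, so together they contribute at most a
    primorial. \<open>A\<close> may meet \<open>B\<close> and \<open>D\<close>, hence the
    differences.\<close>
  have pf: "prime_factors (2 * n choose n) \<subseteq> A \<union> (B - A) \<union> (D - A)"
  proof
    fix p assume p: "p \<in> prime_factors (2 * n choose n)"
    hence pp: "prime p" and v0: "v p > 0" by (auto simp: v_def prime_factors_multiplicity)
    have "p ^ 1 \<le> p ^ v p" using v0 prime_gt_0_nat[OF pp] by (intro power_increasing) auto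
    hence "p \<le> 2 * n" using pow[OF pp] by simp
    moreover have "\<not> (p \<le> n \<and> 2 * n < 3 * p)"
      using multiplicity_central_binomial_eq_0[OF pp n] v0 by (auto simp: v_def)
    hence "n < p \<or> p \<le> 2 * n div 3" by linarith
    ultimately show "p \<in> A \<union> (B - A) \<union> (D - A)" using pp by (auto simp: A_def B_def D_def)
  qed
  have "2 * n choose n = (\<Prod>p\<in>prime_factors (2 * n choose n). p ^ v p)"
    unfolding v_def by (rule prime_factorization_nat) simp
  also have "\<dots> \<le> (\<Prod>p\<in>A \<union> (B - A) \<union> (D - A). p ^ v p)"
    using fin finA pf
    by (intro dvd_imp_le prod_dvd_prod_subset prod_pos) (auto simp: A_def B_def D_def prime_gt_0_nat)
  also have "\<dots> = (\<Prod>p\<in>A. p ^ v p) * (\<Prod>p\<in>B - A. p ^ v p) * (\<Prod>p\<in>D - A. p ^ v p)"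
  proof -
    have "B \<inter> D = {}" by (auto simp: B_def D_def)
    thus ?thesis using fin finA
      by (subst prod.union_disjoint; (subst prod.union_disjoint)?) auto
  qed
  also have "\<dots> \<le> (\<Prod>p\<in>A. 2 * n) * (\<Prod>p\<in>B. p) * (\<Prod>p\<in>D. 2 * n)"
  proof (intro mult_le_mono)
    show "(\<Prod>p\<in>A. p ^ v p) \<le> (\<Prod>p\<in>A. 2 * n)"
      by (intro prod_mono) (auto simp: A_def pow)
    have "(\<Prod>p\<in>B - A. p ^ v p) \<le> (\<Prod>p\<in>B - A. p ^ 1)"
      using v1 by (intro prod_mono conjI power_increasing) (auto simp: B_def prime_gt_0_nat Suc_leI)
    also have "\<dots> \<le> (\<Prod>p\<in>B. p ^ 1)"
      using fin by (intro dvd_imp_le prod_dvd_prod_subset prod_pos) (auto simp: B_def prime_gt_0_nat)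
    finally show "(\<Prod>p\<in>B - A. p ^ v p) \<le> (\<Prod>p\<in>B. p)" by simp
    have "(\<Prod>p\<in>D - A. p ^ v p) \<le> (\<Prod>p\<in>D - A. 2 * n)"
      by (intro prod_mono) (auto simp: D_def pow)
    also have "\<dots> \<le> (\<Prod>p\<in>D. 2 * n)"
      using fin n by (intro dvd_imp_le prod_dvd_prod_subset prod_pos) auto
    finally show "(\<Prod>p\<in>D - A. p ^ v p) \<le> (\<Prod>p\<in>D. 2 * n)" .
  qed
  also have "(\<Prod>p\<in>B. p) \<le> 4 ^ (2 * n div 3)"
    using primorial_le[of "2 * n div 3"] by (simp add: primorial_def B_def)
  finally show ?thesis unfolding A_def D_def by (simp add: mult_le_mono)
qed

text \<open>Logarithms of the preceding bound, compared with
  \<open>4 ^ n / (2 * n) \<le> 2 * n choose n\<close>. The \<open>+ 1\<close> beside the square root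
  is the denominator \<open>2 * n\<close>; the main term is \<open>n * ln 4\<close> less two thirds
  of itself.\<close>

lemma card_primes_dyadic_ge:
  fixes n :: nat
  assumes n: "n \<ge> 5"
  shows "real (card {p. prime p \<and> n < p \<and> p \<le> 2 * n}) * ln (2 * real n) \<ge>
    real n * ln 4 / 3 - (sqrt (2 * real n) + 1) * ln (2 * real n)"
proof -
  define a where "a = card {p::nat. prime p \<and> p\<^sup>2 \<le> 2 * n}"
  define d where "d = card {p::nat. prime p \<and> n < p \<and> p \<le> 2 * n}"
  define m where "m = 2 * n div 3"
  have m: "real m \<le> 2 * real n / 3" unfolding m_def by linarith
  have ln_nonneg: "ln (2 * real n) \<ge> 0" using n by simp
  have "{p::nat. prime p \<and> p\<^sup>2 \<le> 2 * n} \<subseteq> {1..nat \<lfloor>sqrt (2 * real n)\<rfloor>}"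
  proof
    fix p :: nat assume "p \<in> {p. prime p \<and> p\<^sup>2 \<le> 2 * n}"
    hence "prime p" and "real (p\<^sup>2) \<le> real (2 * n)" by (auto simp del: of_nat_power of_nat_mult)
    hence "real p \<le> sqrt (2 * real n)" by (intro real_le_rsqrt) simp
    hence "p \<le> nat \<lfloor>sqrt (2 * real n)\<rfloor>" by (simp add: le_nat_floor)
    thus "p \<in> {1..nat \<lfloor>sqrt (2 * real n)\<rfloor>}" using prime_gt_0_nat[OF \<open>prime p\<close>] by simp
  qed
  from card_mono[OF _ this] have "a \<le> nat \<lfloor>sqrt (2 * real n)\<rfloor>" unfolding a_def by simp
  hence "real a \<le> real (nat \<lfloor>sqrt (2 * real n)\<rfloor>)" by (simp only: of_nat_le_iff)
  also have "\<dots> \<le> sqrt (2 * real n)" by (intro of_nat_floor) simp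
  finally have a: "real a \<le> sqrt (2 * real n)" .
  have "4 ^ n / (2 * real n) \<le> real (2 * n choose n)"
    using n by (intro central_binomial_lower_bound) simp
  also have "\<dots> \<le> real ((2 * n) ^ a * 4 ^ m * (2 * n) ^ d)"
    using central_binomial_le_prod[OF n] unfolding a_def d_def m_def by (simp only: of_nat_le_iff)
  finally have "4 ^ n / (2 * real n) \<le> (2 * real n) ^ a * 4 ^ m * (2 * real n) ^ d" by simp
  hence "ln (4 ^ n / (2 * real n)) \<le> ln ((2 * real n) ^ a * 4 ^ m * (2 * real n) ^ d)"
    using n by (subst ln_le_cancel_iff) auto
  also have "ln (4 ^ n / (2 * real n)) = real n * ln 4 - ln (2 * real n)"
    using n by (simp add: ln_divide_pos ln_realpow)
  also have "ln ((2 * real n) ^ a * 4 ^ m * (2 * real n) ^ d) =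
      real a * ln (2 * real n) + real m * ln 4 + real d * ln (2 * real n)"
  proof -
    have "2 * real n > 0" using n by simp
    thus ?thesis by (simp only: ln_mult_pos ln_realpow zero_less_power zero_less_mult_iff zero_less_numeral simp_thms)
  qed
  finally have "real n * ln 4 - ln (2 * real n) \<le>
      real a * ln (2 * real n) + real m * ln 4 + real d * ln (2 * real n)" .
  moreover have "real a * ln (2 * real n) \<le> sqrt (2 * real n) * ln (2 * real n)"
    using a ln_nonneg by (rule mult_right_mono)
  moreover have "real m * ln 4 \<le> 2 / 3 * (real n * ln 4)"
    using mult_right_mono[OF m, of "ln 4"] by simp
  moreover have "real n * ln 4 / 3 = 1 / 3 * (real n * ln 4)" by simp
  ultimately show ?thesis unfolding d_def[symmetric] distrib_right by linarith
qed

text \<open>The shape is dictated by the sieve: with \<open>n\<close> half of \<open>u\<close>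
  rounded down, \<open>2 * n + 1\<close> also covers odd \<open>u\<close>, the factor 5 is half of
  the 10 in the condition on \<open>u\<close>, and the constant absorbs the two extra
  survivors.\<close>

lemma eventually_card_primes_dyadic_ge:
  "eventually (\<lambda>n. real (card {p. prime p \<and> n < p \<and> p \<le> 2 * n}) \<ge>
     (2 * real n + 1) / (5 * ln (2 * real n)) + 3) sequentially"
proof -
  have "eventually (\<lambda>n. (4 / 9) * real n - (sqrt (2 * real n) + 1) * ln (2 * real n) \<ge>
      (2 * real n + 1) / 5 + 3 * ln (2 * real n)) sequentially"
    by real_asymp
  with eventually_ge_at_top[of 5] show ?thesis
  proof eventually_elim
    case (elim n)
    have pos: "ln (2 * real n) > 0" using elim by simp
    have "ln (4 :: real) = 2 * ln 2" using ln_realpow[of 2 2] by simp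
    hence "4 / 3 * real n \<le> real n * ln 4"
      using ln2_ge_two_thirds mult_left_mono[of "4/3" "ln 4" "real n"] by simp
    hence "(2 * real n + 1) / 5 + 3 * ln (2 * real n) \<le>
        real (card {p. prime p \<and> n < p \<and> p \<le> 2 * n}) * ln (2 * real n)"
      using card_primes_dyadic_ge[OF elim(1)] elim(2) by simp
    thus ?case using pos by (simp add: field_simps)
  qed
qed

subsection \<open>Sieving\<close>

text \<open>
  \<open>covers P A\<close>: the integers in \<open>A\<close> can be removed by sieving with one residue class
  \<open>r p\<close> modulo each \<open>p \<in> P\<close>.
\<close>

definition covers :: "nat set \<Rightarrow> int set \<Rightarrow> bool" where
  "covers P A \<longleftrightarrow> (\<exists>r. \<forall>m\<in>A. \<exists>p\<in>P. int p dvd m - r p)"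

lemma chinese_remainder_primes:
  fixes P :: "nat set" and r :: "nat \<Rightarrow> int"
  assumes "finite P" "\<And>p. p \<in> P \<Longrightarrow> prime p"
  shows "\<exists>N. \<forall>p\<in>P. int p dvd N + r p"
  using assms
proof (induction P rule: finite_induct)
  case (insert p P)
  then obtain N where N: "\<forall>p\<in>P. int p dvd N + r p" by auto
  have "coprime (int p) (\<Prod>p\<in>P. int p)"
    using insert by (intro prod_coprime_right) (auto intro: primes_coprime)
  then obtain N' where N': "[N' = - r p] (mod int p)" "[N' = N] (mod (\<Prod>p\<in>P. int p))"
    using binary_chinese_remainder_int by blast
  have "int p' dvd N' + r p'" if "p' \<in> P" for p'
  proof -
    have "int p' dvd (\<Prod>p\<in>P. int p)" using insert.hyps(1) that by (rule dvd_prodI)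
    hence "int p' dvd N' - N" using N'(2) by (meson cong_iff_dvd_diff dvd_trans)
    moreover have "int p' dvd N + r p'" using N that by blast
    ultimately show ?thesis by (metis dvd_add diff_add_cancel add.assoc)
  qed
  moreover have "int p dvd N' + r p" using N'(1) by (simp add: cong_iff_dvd_diff)
  ultimately show ?case by auto
qed simp

text \<open>Taking \<open>N\<close> congruent to \<open>- r p\<close> modulo every \<open>p\<close>
  moves all the removed classes to the class 0, so a covering becomes a run of integers each
  divisible by some prime in \<open>P\<close>.\<close>

lemma covers_imp_translate:
  assumes "finite P" "\<And>p. p \<in> P \<Longrightarrow> prime p" "covers P A"
  shows "\<exists>N. \<forall>m\<in>A. \<exists>p\<in>P. int p dvd N + m"
proof -
  obtain r where r: "\<forall>m\<in>A. \<exists>p\<in>P. int p dvd m - r p" using assms(3) by (auto simp: covers_def)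
  obtain N where N: "\<forall>p\<in>P. int p dvd N + r p" using chinese_remainder_primes assms by blast
  have "int p dvd N + m" if "p \<in> P" "int p dvd m - r p" for p m
    using dvd_add[of "int p" "N + r p" "m - r p"] N that by simp
  thus ?thesis using r by blast
qed

lemma covers_Un:
  assumes "covers P A" "covers Q B" "P \<inter> Q = {}"
  shows "covers (P \<union> Q) (A \<union> B)"
proof -
  from assms obtain r s where r: "\<forall>m\<in>A. \<exists>p\<in>P. int p dvd m - r p"
    and s: "\<forall>m\<in>B. \<exists>p\<in>Q. int p dvd m - s p" by (auto simp: covers_def)
  have "\<forall>m\<in>A \<union> B. \<exists>p\<in>P \<union> Q. int p dvd m - (if p \<in> P then r p else s p)"
  proof
    fix m assume "m \<in> A \<union> B"
    thus "\<exists>p\<in>P \<union> Q. int p dvd m - (if p \<in> P then r p else s p)"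
    proof
      assume "m \<in> A"
      with r obtain p where "p \<in> P" "int p dvd m - r p" by blast
      thus ?thesis by (intro bexI[of _ p]) auto
    next
      assume "m \<in> B"
      with s obtain p where "p \<in> Q" "int p dvd m - s p" by blast
      thus ?thesis using assms(3) by (intro bexI[of _ p]) auto
    qed
  qed
  thus ?thesis unfolding covers_def by (rule exI[of _ "\<lambda>p. if p \<in> P then r p else s p"])
qed

lemma covers_if_card_le:
  assumes "finite P" "finite A" "card A \<le> card P"
  shows "covers P A"
proof -
  obtain f where f: "f ` A \<subseteq> P" "inj_on f A" using card_le_inj[OF assms(2,1,3)] by blast
  \<comment> \<open>Each \<open>m\<close> gets its own prime \<open>f m\<close>, whose residue class
    is that of \<open>m\<close> itself; so \<open>r\<close> is an inverse of
    \<open>f\<close>.\<close>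
  show ?thesis unfolding covers_def
    by (rule exI[of _ "inv_into A f"]) (use f in \<open>auto intro!: bexI\<close>)
qed

text \<open>Pigeonhole: the \<open>p\<close> residue classes partition \<open>B\<close>, so one
  reaches the average size.\<close>

lemma exists_popular_residue:
  fixes B :: "int set" and p :: nat
  assumes p: "p > 0" and B: "finite B"
  shows "\<exists>c. real (card B) / real p \<le> real (card {m \<in> B. int p dvd m - c})"
proof (rule ccontr)
  assume "\<not> ?thesis"
  hence less: "real (card {m \<in> B. int p dvd m - c}) < real (card B) / real p" for c
    by (auto simp: not_le)
  have "card B = (\<Sum>c\<in>{0..<int p}. card {m \<in> B. m mod int p = c})"
    using B p sum.group[of B "{0..<int p}" "\<lambda>m. m mod int p" "\<lambda>_. 1 :: nat"]
    by (simp add: image_subset_iff)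
  also have "\<dots> = (\<Sum>c\<in>{0..<int p}. card {m \<in> B. int p dvd m - c})"
    by (intro sum.cong arg_cong[of _ _ card] Collect_cong)
       (auto simp: mod_eq_dvd_iff[symmetric])
  finally have "real (card B) = (\<Sum>c\<in>{0..<int p}. real (card {m \<in> B. int p dvd m - c}))" by simp
  also have "\<dots> < (\<Sum>c\<in>{0..<int p}. real (card B) / real p)"
    using p less by (intro sum_strict_mono) auto
  also have "\<dots> = real (card B)" using p by simp
  finally show False by simp
qed

text \<open>Each prime in turn removes the most popular class among the current survivors, leaving
  at most a fraction \<open>1 - 1 / p\<close> of them. \<open>C\<close> is what survives in the
  end.\<close>

lemma greedy_sieve:
  fixes B :: "int set" and Q :: "nat set"
  assumes "finite Q" "\<And>p. p \<in> Q \<Longrightarrow> p > 0" and B: "finite B"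
  shows "\<exists>C\<subseteq>B. covers Q (B - C) \<and> real (card C) \<le> real (card B) * (\<Prod>p\<in>Q. 1 - 1 / real p)"
  using assms(1,2)
proof (induction Q rule: finite_induct)
  case empty
  show ?case by (rule exI[of _ B]) (auto simp: covers_def)
next
  case (insert p Q)
  then obtain C where C: "C \<subseteq> B" "covers Q (B - C)"
    "real (card C) \<le> real (card B) * (\<Prod>p\<in>Q. 1 - 1 / real p)" by auto
  have fin: "finite C" using C(1) B by (rule finite_subset)
  have p: "p > 0" using insert by simp
  from exists_popular_residue[OF p fin] obtain c
    where c: "real (card C) / real p \<le> real (card {m \<in> C. int p dvd m - c})" ..
  define D where "D = {m \<in> C. int p dvd m - c}"
  have D: "D \<subseteq> C" "finite D" using fin by (auto simp: D_def)
  have "covers {p} D" unfolding covers_def D_def by (intro exI[of _ "\<lambda>_. c"]) auto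
  hence "covers ({p} \<union> Q) (D \<union> (B - C))" using C(2) insert by (intro covers_Un) auto
  moreover have "B - (C - D) = D \<union> (B - C)" using C(1) D(1) by auto
  ultimately have "covers (insert p Q) (B - (C - D))" by simp
  moreover have "C - D \<subseteq> B" using C by auto
  moreover have "real (card (C - D)) \<le> real (card B) * (\<Prod>p\<in>insert p Q. 1 - 1 / real p)"
  proof -
    have "real (card (C - D)) = real (card C) - real (card D)"
      using D fin by (simp add: card_Diff_subset of_nat_diff card_mono)
    hence "real (card (C - D)) \<le> real (card C) * (1 - 1 / real p)"
      using c by (simp add: D_def algebra_simps)
    also have "\<dots> \<le> real (card B) * (\<Prod>p\<in>Q. 1 - 1 / real p) * (1 - 1 / real p)"
      using p C(3) by (intro mult_right_mono) auto
    also have "\<dots> = real (card B) * (\<Prod>p\<in>insert p Q. 1 - 1 / real p)" using insert by simp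
    finally show ?thesis .
  qed
  ultimately show ?case by blast
qed

section \<open>Sieving the arithmetic progression\<close>

lemma composite_imp_small_prime_factor:
  fixes n :: nat
  assumes "n > 1" "\<not> prime n"
  shows "\<exists>p. prime p \<and> p dvd n \<and> p\<^sup>2 \<le> n"
proof -
  obtain a where "a dvd n" "a \<noteq> 1" "a \<noteq> n" using assms by (auto simp: prime_nat_iff)
  then obtain c where n: "n = a * c" "a \<noteq> 1" "c \<noteq> 1" using assms by (auto elim!: dvdE)
  define m where "m = min a c"
  have "m \<noteq> 1" "m dvd n" using n by (auto simp: m_def min_def)
  then obtain p where p: "prime p" "p dvd m" using prime_factor_nat by blast
  have "m > 0" using n assms by (auto simp: m_def)
  hence "p \<le> m" using p by (intro dvd_imp_le)
  hence "p\<^sup>2 \<le> a * c" by (auto simp: m_def power2_eq_square intro: mult_le_mono)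
  thus ?thesis using p \<open>m dvd n\<close> n by (auto intro: dvd_trans)
qed

text \<open>The Euler product of \<open>totient n / n\<close> runs over all prime factors of
  \<open>n\<close>. Two of them above \<open>sqrt x\<close> would multiply to at least
  \<open>x > n\<close>, so at most one factor is missing on the left, and it is at least
  1/2.\<close>

lemma prod_small_prime_factors_le:
  fixes x :: real and n :: nat
  assumes n: "0 < n" "real n < x" and x: "x \<ge> 4"
  shows "(\<Prod>p\<in>{p. prime p \<and> real p \<le> sqrt x \<and> p dvd n}. 1 - 1 / real p) \<le>
    2 * (real (totient n) / real n)"
proof -
  define S where "S = {p. prime p \<and> real p \<le> sqrt x \<and> p dvd n}"
  define L where "L = {p. prime p \<and> real p > sqrt x \<and> p dvd n}"
  have pf: "prime_factors n = S \<union> L" using n by (auto simp: S_def L_def prime_factors_dvd)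
  have fin: "finite S" "finite L" using pf by (metis finite_Un finite_set_mset)+
  have "p = r" if "p \<in> L" "r \<in> L" for p r
  proof (rule ccontr)
    assume "p \<noteq> r"
    hence "p * r dvd n" using that by (intro divides_mult primes_coprime) (auto simp: L_def)
    hence "real p * real r \<le> real n" using n(1) by (metis dvd_imp_le of_nat_le_iff of_nat_mult)
    moreover have "sqrt x * sqrt x \<le> real p * real r"
      using that x by (intro mult_mono) (auto simp: L_def)
    ultimately show False using n x by simp
  qed
  hence "card L \<le> Suc 0" using fin by (simp add: card_le_Suc0_iff_eq)
  hence "L = {} \<or> (\<exists>p. L = {p})" using fin by (auto simp: le_Suc_eq card_Suc_eq)
  moreover have "real p \<ge> 2" if "p \<in> L" for p
    using that prime_ge_2_nat by (fastforce simp: L_def)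
  ultimately have half: "(\<Prod>p\<in>L. 1 - 1 / real p) \<ge> 1 / 2" by (auto simp: field_simps)
  have nonneg: "(\<Prod>p\<in>S. 1 - 1 / real p) \<ge> 0"
    by (intro prod_nonneg) (auto simp: S_def dest!: prime_gt_0_nat)
  have "real (totient n) / real n = (\<Prod>p\<in>S \<union> L. 1 - 1 / real p)"
    using totient_formula2[of n] n(1) by (simp add: pf)
  also have "\<dots> = (\<Prod>p\<in>S. 1 - 1 / real p) * (\<Prod>p\<in>L. 1 - 1 / real p)"
    using fin by (intro prod.union_disjoint) (auto simp: S_def L_def)
  also have "\<dots> \<ge> (\<Prod>p\<in>S. 1 - 1 / real p) * (1 / 2)"
    using half nonneg by (rule mult_left_mono)
  finally show ?thesis unfolding S_def by (simp add: mult.commute)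
qed

text \<open>If \<open>m\<close> survives, \<open>q * m + b\<close> has no prime factor up to
  \<open>sqrt x\<close>: those not dividing \<open>q\<close> are sieved out, and those dividing
  \<open>q\<close> would divide \<open>gcd b q\<close>. Being at most \<open>x\<close>, it is a
  prime congruent to \<open>b\<close>, or 1; the value 1 causes the \<open>+ 1\<close>.\<close>

lemma covers_progression_up_to_primes:
  fixes x :: real and q b M :: int
  assumes q: "real_of_int q < x" "b < q" "0 < b" "gcd b q = 1"
    and M: "real_of_int (q * M + b) \<le> x"
  shows "\<exists>B\<subseteq>{0..M}. covers {p. prime p \<and> real p \<le> sqrt x \<and> \<not> int p dvd q} ({0..M} - B) \<and>
    card B \<le> prime_count_ap x q b + 1"
proof -
  define P where "P = {p. prime p \<and> real p \<le> sqrt x \<and> \<not> int p dvd q}"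
  have "\<exists>c. int p dvd q * c + b" if "p \<in> P" for p
  proof -
    have "coprime (int p) q" using that by (intro prime_imp_coprime) (auto simp: P_def)
    then obtain c where "[q * c = 1] (mod int p)"
      using cong_solve_coprime_int by (metis coprime_commute)
    \<comment> \<open>With \<open>c\<close> inverse to \<open>q\<close> modulo \<open>p\<close>, the
      class on which \<open>p\<close> divides \<open>q * m + b\<close> is that of
      \<open>c * (- b)\<close>.\<close>
    hence "[q * c * (- b) + b = 1 * (- b) + b] (mod int p)"
      by (intro cong_add cong_mult cong_refl)
    hence "int p dvd q * (c * (- b)) + b" by (simp add: cong_0_iff mult.assoc)
    thus ?thesis ..
  qed
  then obtain r where r: "\<And>p. p \<in> P \<Longrightarrow> int p dvd q * r p + b" by metis
  define B where "B = {m \<in> {0..M}. \<forall>p\<in>P. \<not> int p dvd m - r p}"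
  define T where "T = {p :: int. prime p \<and> real_of_int p \<le> x \<and> [p = b] (mod q)}"
  have "T \<subseteq> {0..\<lfloor>x\<rfloor>}" by (auto simp: T_def le_floor_iff dest: prime_ge_0_int)
  hence finT: "finite T" by (rule finite_subset) auto
  have "(\<lambda>m. q * m + b) ` B \<subseteq> insert 1 T"
  proof
    fix n assume "n \<in> (\<lambda>m. q * m + b) ` B"
    then obtain m where m: "n = q * m + b" "0 \<le> m" "m \<le> M" "\<And>p. p \<in> P \<Longrightarrow> \<not> int p dvd m - r p"
      by (auto simp: B_def)
    have "n > 0" using m q by (auto intro!: add_nonneg_pos)
    have "q * m \<le> q * M" using m q by (intro mult_left_mono) auto
    hence "real_of_int n \<le> real_of_int (q * M + b)" unfolding m(1) of_int_le_iff by simp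
    hence nx: "real_of_int n \<le> x" using M by linarith
    have "prime n" if "n \<noteq> 1"
    proof (rule ccontr)
      assume "\<not> prime n"
      obtain k where k: "n = int k" using \<open>n > 0\<close> by (meson nonneg_int_cases less_imp_le)
      have "\<not> prime k" "k > 1" using \<open>\<not> prime n\<close> \<open>n > 0\<close> that k by auto
      then obtain p where p: "prime p" "p dvd k" "p\<^sup>2 \<le> k"
        using composite_imp_small_prime_factor by blast
      have pn: "int p dvd n" using p(2) by (simp add: k)
      have "(real p)\<^sup>2 \<le> real k" using p(3) by (metis of_nat_le_iff of_nat_power)
      also have "\<dots> \<le> x" using nx by (simp add: k)
      finally have "(real p)\<^sup>2 \<le> x" .
      hence "real p \<le> sqrt x" by (rule real_le_rsqrt)
      moreover have "\<not> int p dvd q"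
      proof
        assume pq: "int p dvd q"
        have "int p dvd q * m" using pq by simp
        hence "int p dvd b" using pn unfolding m(1) by (simp only: dvd_add_right_iff)
        hence "int p dvd gcd b q" using pq by simp
        thus False using q(4) p(1) by simp
      qed
      ultimately have "p \<in> P" using p(1) by (simp add: P_def)
      hence "int p dvd n - (q * r p + b)" using pn r by (intro dvd_diff)
      also have "n - (q * r p + b) = q * (m - r p)" by (simp add: m(1) algebra_simps)
      finally have "int p dvd q \<or> int p dvd m - r p" using p(1) by (intro prime_dvd_multD) simp_all
      thus False using \<open>p \<in> P\<close> m(4) by (auto simp: P_def)
    qed
    moreover have "[n = b] (mod q)" unfolding m(1) by (simp add: cong_iff_dvd_diff)
    ultimately show "n \<in> insert 1 T" using nx by (auto simp: T_def)
  qed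
  moreover have "inj_on (\<lambda>m. q * m + b) B" using q by (intro inj_onI) simp
  ultimately have "card B \<le> card (insert 1 T)" using finT by (intro card_inj_on_le) auto
  also have "\<dots> \<le> card T + 1" using finT by (simp add: card_insert_if)
  finally have "card B \<le> prime_count_ap x q b + 1" by (simp add: prime_count_ap_def T_def)
  moreover have "covers P ({0..M} - B)" unfolding covers_def by (rule exI[of _ r]) (auto simp: B_def)
  moreover have "B \<subseteq> {0..M}" by (auto simp: B_def)
  ultimately show ?thesis unfolding P_def by blast
qed

lemma covers_progression:
  fixes x \<delta> :: real and q b u M :: int
  assumes x: "x \<ge> 4" and q: "real_of_int q < x" "b < q" "0 < b" "gcd b q = 1"
    and M: "real_of_int (q * M + b) \<le> x"
    and \<delta>: "0 \<le> \<delta>" "real (prime_count_ap x q b) \<le> \<delta> * x / real (totient (nat q))"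
    and u: "real_of_int u \<ge> sqrt x" "real_of_int u / ln (real_of_int u) \<ge> 10 * \<delta> * x / real_of_int q"
    and many: "real (card {p :: nat. prime p \<and> sqrt x < real p \<and> int p \<le> u}) \<ge>
      real_of_int u / (5 * ln (real_of_int u)) + 2"
  shows "covers {p. prime p \<and> int p \<le> u} {0..M}"
proof -
  define P1 where "P1 = {p. prime p \<and> real p \<le> sqrt x \<and> \<not> int p dvd q}"
  define P2 where "P2 = {p. prime p \<and> real p \<le> sqrt x \<and> int p dvd q}"
  define P3 where "P3 = {p :: nat. prime p \<and> sqrt x < real p \<and> int p \<le> u}"
  have "P2 \<union> P3 \<subseteq> {..nat \<lfloor>sqrt x\<rfloor>} \<union> {..nat u}"
    by (auto simp: P2_def P3_def le_nat_floor)
  hence fin: "finite P2" "finite P3" by (meson finite_Un finite_atMost finite_subset)+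
  obtain B where B: "B \<subseteq> {0..M}" "covers P1 ({0..M} - B)" "card B \<le> prime_count_ap x q b + 1"
    using covers_progression_up_to_primes[OF q M] unfolding P1_def by blast
  have finB: "finite B" using B(1) by (rule finite_subset) auto
  have "\<exists>C\<subseteq>B. covers P2 (B - C) \<and> real (card C) \<le> real (card B) * (\<Prod>p\<in>P2. 1 - 1 / real p)"
    using fin(1) _ finB by (rule greedy_sieve) (auto simp: P2_def prime_gt_0_nat)
  then obtain C where C: "C \<subseteq> B" "covers P2 (B - C)"
    "real (card C) \<le> real (card B) * (\<Prod>p\<in>P2. 1 - 1 / real p)" by blast
  have finC: "finite C" using C(1) finB by (rule finite_subset)
  define t where "t = real (totient (nat q))"
  have qpos: "real_of_int q > 0" using q by simp
  have t: "t > 0" "t \<le> real_of_int q"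
    using q totient_le[of "nat q"] by (auto simp: t_def)
  have P2_eq: "P2 = {p. prime p \<and> real p \<le> sqrt x \<and> p dvd nat q}"
    using q by (auto simp: P2_def int_dvd_int_iff[symmetric])
  have "(\<Prod>p\<in>P2. 1 - 1 / real p) \<le> 2 * (t / real_of_int q)"
    using prod_small_prime_factors_le[of "nat q" x] q x unfolding P2_eq t_def by simp
  hence "real (card C) \<le> real (card B) * (2 * (t / real_of_int q))"
    using C(3) by (meson mult_left_mono of_nat_0_le_iff order_trans)
  also have "\<dots> \<le> (\<delta> * x / t + 1) * (2 * (t / real_of_int q))"
    using B(3) \<delta>(2) t qpos by (intro mult_right_mono) (auto simp: t_def)
  also have "\<dots> = 2 * (\<delta> * x / real_of_int q) + 2 * (t / real_of_int q)"
    using t qpos by (simp add: field_simps)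
  also have "\<dots> \<le> 2 * (\<delta> * x / real_of_int q) + 2" using t qpos by (simp add: divide_le_eq)
  \<comment> \<open>The condition on \<open>u\<close> divided by 5. The additive 2 comes from the
    survivor with value 1, doubled by the possible large prime factor of \<open>q\<close>.\<close>
  also have "\<dots> \<le> real_of_int u / (5 * ln (real_of_int u)) + 2" using u(2) by simp
  also have "\<dots> \<le> real (card P3)" using many unfolding P3_def .
  finally have "covers P3 C" using fin finC by (intro covers_if_card_le) simp_all
  hence "covers (P2 \<union> P3) ((B - C) \<union> C)" by (rule covers_Un[OF C(2)]) (auto simp: P2_def P3_def)
  hence "covers (P1 \<union> (P2 \<union> P3)) (({0..M} - B) \<union> ((B - C) \<union> C))"
    by (rule covers_Un[OF B(2)]) (auto simp: P1_def P2_def P3_def)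
  moreover have "({0..M} - B) \<union> ((B - C) \<union> C) = {0..M}" using B(1) C(1) by auto
  moreover have "P1 \<union> (P2 \<union> P3) = {p. prime p \<and> int p \<le> u}"
    using u(1) by (auto simp: P1_def P2_def P3_def not_le)
  ultimately show ?thesis by simp
qed

subsection \<open>Gaps\<close>

text \<open>The ends are the last element up to \<open>l\<close> and the first from \<open>h\<close>
  on. The elements \<open>s\<close> and \<open>t\<close> ensure that both exist, as extrema over
  finite intervals.\<close>

lemma exists_consecutive_in:
  fixes S :: "int set"
  assumes "s \<in> S" "s \<le> l" "t \<in> S" "h \<le> t" "l < h" and empty: "S \<inter> {l<..<h} = {}"
  shows "\<exists>a b. consecutive_in S a b \<and> a \<le> l \<and> h \<le> b \<and> b \<le> t"
proof -
  define a b where "a = Max (S \<inter> {s..l})" and "b = Min (S \<inter> {h..t})"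
  have a: "a \<in> S" "s \<le> a" "a \<le> l" "\<And>c. c \<in> S \<Longrightarrow> c \<le> l \<Longrightarrow> c \<le> a"
  proof -
    have "a \<in> S \<inter> {s..l}" unfolding a_def by (rule Max_in) (use assms in auto)
    thus "a \<in> S" "s \<le> a" "a \<le> l" by auto
    show "c \<le> a" if "c \<in> S" "c \<le> l" for c
      using that \<open>s \<le> a\<close> by (cases "s \<le> c") (auto simp: a_def)
  qed
  have b: "b \<in> S" "h \<le> b" "b \<le> t" "\<And>c. c \<in> S \<Longrightarrow> h \<le> c \<Longrightarrow> b \<le> c"
  proof -
    have "b \<in> S \<inter> {h..t}" unfolding b_def by (rule Min_in) (use assms in auto)
    thus "b \<in> S" "h \<le> b" "b \<le> t" by auto
    show "b \<le> c" if "c \<in> S" "h \<le> c" for c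
      using that \<open>b \<le> t\<close> by (cases "c \<le> t") (auto simp: b_def)
  qed
  have "S \<inter> {a<..<b} = {}"
  proof (rule equals0I)
    fix c assume "c \<in> S \<inter> {a<..<b}"
    thus False using a(4)[of c] b(4)[of c] empty by force
  qed
  thus ?thesis using a(1,3) b(1-3) assms(5) unfolding consecutive_in_def by fastforce
qed

lemma max_gap_ge:
  assumes "finite {b - a |a b. consecutive_in S a b}" "consecutive_in S a b"
  shows "b - a \<le> max_gap S"
  unfolding max_gap_def using assms by (intro Max_ge) auto

lemma max_gap_attained:
  assumes "finite {b - a |a b. consecutive_in S a b}" "consecutive_in S a b"
  shows "\<exists>a b. consecutive_in S a b \<and> b - a = max_gap S"
proof -
  have "max_gap S \<in> {b - a |a b. consecutive_in S a b}"
    unfolding max_gap_def using assms by (intro Max_in) auto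
  then obtain a b where "max_gap S = b - a" "consecutive_in S a b" by blast
  thus ?thesis by metis
qed

lemma finite_gaps:
  assumes "finite S"
  shows "finite {b - a |a b. consecutive_in S a b}"
proof (rule finite_subset)
  show "{b - a |a b. consecutive_in S a b} \<subseteq> (\<lambda>(a, b). b - a) ` (S \<times> S)"
    by (auto simp: consecutive_in_def)
qed (use assms in auto)

section \<open>The sifted set and Jacobsthal's function\<close>

definition sifted :: "int \<Rightarrow> int set" where
  "sifted u = {n. \<not> (\<exists>p. prime p \<and> real_of_int p \<le> real_of_int u \<and> p dvd n)}"

lemma jacobsthal_eq: "jacobsthal (real_of_int u) = max_gap (sifted u)"
  by (simp add: jacobsthal_def sifted_def)

lemma prime_dvd_primorial:
  fixes p :: int
  assumes "prime p" "p \<le> u"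
  shows "p dvd int (primorial (nat u))"
proof -
  obtain k where k: "p = int k" using prime_ge_0_int[OF assms(1)] by (rule nonneg_int_cases)
  have "finite {p. prime p \<and> p \<le> nat u}" by simp
  moreover have "k \<in> {p. prime p \<and> p \<le> nat u}" using assms k by auto
  ultimately have "k dvd primorial (nat u)"
    unfolding primorial_def by (rule dvd_prodI[where f = "\<lambda>x. x"])
  thus ?thesis by (simp add: k)
qed

lemma sifted_periodic: "m + k * int (primorial (nat u)) \<in> sifted u \<longleftrightarrow> m \<in> sifted u"
proof -
  have "p dvd m + k * int (primorial (nat u)) \<longleftrightarrow> p dvd m" if "prime p" "p \<le> u" for p
    using prime_dvd_primorial[OF that] by (simp add: dvd_add_left_iff)
  thus ?thesis unfolding sifted_def of_int_le_iff by blast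
qed

lemma one_in_sifted: "1 \<in> sifted u"
  by (auto simp: sifted_def)

text \<open>By periodicity \<open>a + Q\<close> is sifted too, with \<open>Q\<close> the primorial,
  so the next element after \<open>a\<close> comes no later.\<close>

lemma sifted_gap_le:
  assumes "consecutive_in (sifted u) a b"
  shows "b \<le> a + int (primorial (nat u))"
proof (rule ccontr)
  assume "\<not> ?thesis"
  moreover have "a + 1 * int (primorial (nat u)) \<in> sifted u"
    using assms by (subst sifted_periodic) (simp add: consecutive_in_def)
  ultimately show False using assms primorial_pos[of "nat u"] by (auto simp: consecutive_in_def)
qed

lemma finite_sifted_gaps: "finite {b - a |a b. consecutive_in (sifted u) a b}"
proof (rule finite_subset)
  show "{b - a |a b. consecutive_in (sifted u) a b} \<subseteq> {0..int (primorial (nat u))}"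
  proof clarify
    fix a b assume "consecutive_in (sifted u) a b"
    thus "b - a \<in> {0..int (primorial (nat u))}"
      using sifted_gap_le[of u a b] by (auto simp: consecutive_in_def)
  qed
qed auto

lemma consecutive_sifted_around:
  assumes "l < h" "sifted u \<inter> {l<..<h} = {}"
  shows "\<exists>a b. consecutive_in (sifted u) a b \<and> h - l \<le> b - a"
proof -
  define Q where "Q = int (primorial (nat u))"
  have Q: "Q \<ge> 1" using primorial_pos[of "nat u"] by (simp add: Q_def)
  \<comment> \<open>Translates of the sifted element 1 by multiples of the period, far enough out to
    enclose \<open>l\<close> and \<open>h\<close>.\<close>
  define s t where "s = 1 + (- \<bar>l\<bar> - 1) * Q" and "t = 1 + \<bar>h\<bar> * Q"
  have "s \<in> sifted u" "t \<in> sifted u"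
    unfolding s_def t_def Q_def by (simp_all only: sifted_periodic one_in_sifted)
  moreover have "\<bar>l\<bar> * 1 \<le> \<bar>l\<bar> * Q" "\<bar>h\<bar> * 1 \<le> \<bar>h\<bar> * Q" using Q by (simp_all add: mult_left_mono del: mult_1_right)
  hence "s \<le> l" "h \<le> t" using Q unfolding s_def t_def by (simp_all add: algebra_simps)
  ultimately obtain a b where "consecutive_in (sifted u) a b" "a \<le> l" "h \<le> b"
    using exists_consecutive_in[of s "sifted u" l t h] assms by blast
  thus ?thesis by (intro exI[of _ a] exI[of _ b]) auto
qed

text \<open>A covered run \<open>N, ..., N + M\<close> lies strictly between \<open>N - 1\<close>
  and \<open>N + M + 1\<close>, which are \<open>M + 2\<close> apart; the sifted gap around it is at
  least as long.\<close>

lemma jacobsthal_ge: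
  assumes cov: "covers {p. prime p \<and> int p \<le> u} {0..M}" and M: "0 \<le> M"
  shows "M + 2 \<le> jacobsthal (real_of_int u)"
proof -
  have "{p. prime p \<and> int p \<le> u} \<subseteq> {..nat u}" by auto
  hence "finite {p. prime p \<and> int p \<le> u}" by (rule finite_subset) auto
  from covers_imp_translate[OF this _ cov] obtain N
    where N: "\<forall>m\<in>{0..M}. \<exists>p\<in>{p. prime p \<and> int p \<le> u}. int p dvd N + m" by auto
  have "sifted u \<inter> {N - 1<..<N + M + 1} = {}"
  proof (rule equals0I)
    fix n assume n: "n \<in> sifted u \<inter> {N - 1<..<N + M + 1}"
    hence "n - N \<in> {0..M}" by auto
    with N obtain p where p: "prime p" "int p \<le> u" "int p dvd N + (n - N)" by blast
    hence "prime (int p)" "real_of_int (int p) \<le> real_of_int u" "int p dvd n" by auto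
    thus False using n unfolding sifted_def by blast
  qed
  then obtain a b where ab: "consecutive_in (sifted u) a b" "N + M + 1 - (N - 1) \<le> b - a"
    using consecutive_sifted_around[of "N - 1" "N + M + 1" u] M by auto
  show ?thesis
    using max_gap_ge[OF finite_sifted_gaps ab(1)] ab(2) unfolding jacobsthal_eq by linarith
qed

text \<open>The translated gap ends by \<open>3 * Q\<close>, so the prime supplied by
  \<open>bertrand\<close> lies beyond it while 2 lies before it. Hence it sits inside a gap between
  primes up to \<open>y\<close>.\<close>

lemma jacobsthal_le_prime_gap:
  fixes u :: int and y :: real
  assumes u: "u \<ge> 2" and bertrand: "\<exists>p. prime p \<and> 3 * primorial (nat u) < p \<and> real p \<le> y"
  shows "jacobsthal (real_of_int u) \<le> prime_gap y"
proof -
  define Q where "Q = int (primorial (nat u))"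
  have dvdQ: "p dvd Q" if "prime p" "p \<le> u" for p
    unfolding Q_def using that by (rule prime_dvd_primorial)
  have Qpos: "Q > 0" using primorial_pos[of "nat u"] by (simp add: Q_def)
  have Q2: "Q \<ge> 2" using dvdQ[of 2] u Qpos by (auto intro: zdvd_imp_le)
  have "prime (2 :: int)" "real_of_int 2 \<le> real_of_int u" "(2 :: int) dvd 0" using u by simp_all
  hence "0 \<notin> sifted u" unfolding sifted_def by blast
  moreover have "{-1<..<1} = {0 :: int}" by auto
  \<comment> \<open>This serves only to produce some gap, so that the maximum is over a nonempty set
    and is attained.\<close>
  ultimately have "sifted u \<inter> {-1<..<1} = {}" by simp
  then obtain a0 b0 where "consecutive_in (sifted u) a0 b0"
    using consecutive_sifted_around[of "-1" 1 u] by auto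
  from max_gap_attained[OF finite_sifted_gaps this] obtain a b
    where ab: "consecutive_in (sifted u) a b" "b - a = max_gap (sifted u)" by blast
  \<comment> \<open>This shift makes the left end \<open>a mod Q + Q\<close>, which lies in
    \<open>[Q, 2Q)\<close>.\<close>
  define k where "k = 1 - a div Q"
  define l h where "l = a + k * Q" and "h = b + k * Q"
  have "l = a mod Q + Q" unfolding l_def k_def by (simp add: algebra_simps minus_div_mult_eq_mod[symmetric])
  hence l: "Q \<le> l" "l < 2 * Q" using Qpos pos_mod_bound[of Q a] pos_mod_sign[of Q a] by auto
  have h: "l < h" "h \<le> l + Q" using ab(1) sifted_gap_le[OF ab(1)]
    by (auto simp: consecutive_in_def l_def h_def Q_def)
  define Pr where "Pr = {p :: int. prime p \<and> real_of_int p \<le> y}"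
  obtain p where p: "prime p" "3 * primorial (nat u) < p" "real p \<le> y" using bertrand by blast
  have p3: "3 * Q < int p" using p(2) unfolding Q_def by linarith
  have pPr: "int p \<in> Pr" using p by (simp add: Pr_def)
  have "real_of_int 2 \<le> real_of_int (int p)" using prime_ge_2_nat[OF p(1)] by simp
  hence twoPr: "2 \<in> Pr" using p(3) by (simp add: Pr_def)
  have "Pr \<inter> {l<..<h} = {}"
  proof (rule equals0I)
    fix n assume n: "n \<in> Pr \<inter> {l<..<h}"
    hence "n - k * Q \<in> {a<..<b}" by (auto simp: l_def h_def)
    hence "n - k * Q \<notin> sifted u" using ab(1) by (auto simp: consecutive_in_def)
    hence "n \<notin> sifted u" using sifted_periodic[of n "- k" u] by (simp add: Q_def)
    then obtain r where r: "prime r" "r \<le> u" "r dvd n" by (auto simp: sifted_def)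
    \<comment> \<open>A prime \<open>n\<close> inside the gap would equal its own prime factor
      \<open>r \<le> Q\<close>, yet \<open>n > l \<ge> Q\<close>.\<close>
    have "r = n" using r n by (auto simp: Pr_def intro: primes_dvd_imp_eq)
    moreover have "r \<le> Q" using dvdQ[OF r(1,2)] Qpos by (rule zdvd_imp_le)
    ultimately show False using n l by auto
  qed
  moreover have "2 \<le> l" "h \<le> int p" using Q2 l h p3 by auto
  ultimately obtain a' b' where ab': "consecutive_in Pr a' b'" "a' \<le> l" "h \<le> b'"
    using exists_consecutive_in[of 2 Pr l "int p" h] twoPr pPr h(1) by blast
  have "Pr \<subseteq> {0..\<lfloor>y\<rfloor>}" by (auto simp: Pr_def le_floor_iff dest: prime_ge_0_int)
  hence "finite Pr" by (rule finite_subset) auto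
  from max_gap_ge[OF finite_gaps[OF this] ab'(1)] have "b' - a' \<le> prime_gap y"
    by (simp add: prime_gap_def Pr_def)
  moreover have "b - a = h - l" by (simp add: l_def h_def)
  ultimately show ?thesis using ab' ab(2) unfolding jacobsthal_eq by linarith
qed

section \<open>Existence of the least admissible u\<close>

lemma Least_int_satisfies:
  fixes P :: "int \<Rightarrow> bool"
  assumes "P w" and nonneg: "\<And>v. P v \<Longrightarrow> 0 \<le> v"
  shows "P (LEAST v. P v)"
proof -
  \<comment> \<open>The integers are not well-ordered; since \<open>P\<close> holds only for
    nonnegative integers, the minimum can be taken over the naturals.\<close>
  define k where "k = (LEAST k. P (int k))"
  have "P (int (nat w))" using assms by simp
  hence k: "P (int k)" unfolding k_def by (rule LeastI)
  have "int k \<le> v" if "P v" for v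
  proof -
    have "P (int (nat v))" using that nonneg by simp
    hence "k \<le> nat v" unfolding k_def by (rule Least_le)
    thus ?thesis using nonneg[OF that] by linarith
  qed
  hence "(LEAST v. P v) = int k" using k by (intro Least_equality)
  thus ?thesis using k by simp
qed

text \<open>Admissible integers exist because \<open>n / ln n\<close> tends to infinity, and
  \<open>0 \<le> y\<close> keeps them nonnegative; so the \<open>LEAST\<close> term really has the
  two properties.\<close>

lemma Least_int_growth:
  fixes y c :: real
  assumes "0 \<le> y" and u: "u = (LEAST v :: int. real_of_int v > y \<and> real_of_int v / ln (real_of_int v) \<ge> c)"
  shows "real_of_int u > y" "real_of_int u / ln (real_of_int u) \<ge> c"
proof -
  have "eventually (\<lambda>n. real n > y) sequentially"
    using filterlim_real_sequentially by (simp add: filterlim_at_top_dense)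
  moreover have "filterlim (\<lambda>n. real n / ln (real n)) at_top sequentially" by real_asymp
  hence "eventually (\<lambda>n. real n / ln (real n) \<ge> c) sequentially" by (simp add: filterlim_at_top)
  ultimately have "eventually (\<lambda>n. real n > y \<and> real n / ln (real n) \<ge> c) sequentially"
    by (rule eventually_conj)
  then obtain n where "real n > y \<and> real n / ln (real n) \<ge> c"
    by (auto simp: eventually_sequentially)
  hence "real_of_int (int n) > y \<and> real_of_int (int n) / ln (real_of_int (int n)) \<ge> c" by simp
  from Least_int_satisfies[of "\<lambda>v. real_of_int v > y \<and> real_of_int v / ln (real_of_int v) \<ge> c", OF this]
  have "real_of_int u > y \<and> real_of_int u / ln (real_of_int u) \<ge> c"
    unfolding u using assms(1) by force
  thus "real_of_int u > y" "real_of_int u / ln (real_of_int u) \<ge> c" by simp_all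
qed


theorem theorem1:
  "\<exists>x0 :: real. \<forall>(x :: real) (q :: int) (b :: int) (\<delta> :: real) (u :: int).
     x \<ge> x0 \<longrightarrow> x > real_of_int q \<longrightarrow> q > b \<longrightarrow> b > 0 \<longrightarrow> gcd b q = 1 \<longrightarrow>
     0 \<le> \<delta> \<longrightarrow> \<delta> \<le> 1 \<longrightarrow>
     real (prime_count_ap x q b) \<le> \<delta> * x / real (totient (nat q)) \<longrightarrow>
     u = (LEAST v :: int. real_of_int v > 2 * sqrt x \<and>
            real_of_int v / ln (real_of_int v) \<ge> 10 * \<delta> * x / real_of_int q) \<longrightarrow>
     prime_gap (exp (2 * real_of_int u)) \<ge> jacobsthal (real_of_int u) \<and>
     real_of_int (jacobsthal (real_of_int u)) \<ge> (x - real_of_int b) / real_of_int q"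
proof -
  define pc where "pc n = real (card {p :: nat. prime p \<and> n < p \<and> p \<le> 2 * n})" for n
  \<comment> \<open>The Taylor bound gives \<open>exp 2 \<ge> 1 + 2 + 2 = 5 > 4\<close>; powers of 5
    eventually beat \<open>6 * 4 ^ n\<close>.\<close>
  have exp_2n: "5 ^ n \<le> exp (2 * real n)" for n
  proof -
    have "(5 :: real) \<le> exp 2" using exp_lower_Taylor_quadratic[of 2] by simp
    hence "5 ^ n \<le> exp (2 :: real) ^ n" by (intro power_mono) auto
    thus ?thesis by (simp add: exp_of_nat_mult[symmetric] mult.commute)
  qed
  have "eventually (\<lambda>n. 6 * 4 ^ n \<le> (5 ^ n :: real)) sequentially" by real_asymp
  hence "eventually (\<lambda>n. 6 * 4 ^ n \<le> exp (2 * real n)) sequentially"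
    by eventually_elim (use exp_2n order_trans in blast)
  hence "eventually (\<lambda>n. n \<ge> 5 \<and> pc n \<ge> (2 * real n + 1) / (5 * ln (2 * real n)) + 3 \<and>
      6 * 4 ^ n \<le> exp (2 * real n)) sequentially"
    unfolding pc_def
    by (intro eventually_conj eventually_ge_at_top eventually_card_primes_dyadic_ge)
  then obtain n0 where n0: "\<And>n. n \<ge> n0 \<Longrightarrow> n \<ge> 5 \<and>
      pc n \<ge> (2 * real n + 1) / (5 * ln (2 * real n)) + 3 \<and> 6 * 4 ^ n \<le> exp (2 * real n)"
    unfolding eventually_sequentially by blast
  show ?thesis
  \<comment> \<open>Then \<open>sqrt x \<ge> n0 + 5\<close>, so both \<open>u\<close> and its half
    are beyond \<open>n0\<close>.\<close>
  proof (intro exI[of _ "(real n0 + 5)\<^sup>2"] allI impI)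
    fix x :: real and q b :: int and \<delta> :: real and u :: int
    assume x: "x \<ge> (real n0 + 5)\<^sup>2" and q: "x > real_of_int q" "q > b" "b > 0" "gcd b q = 1"
      and \<delta>: "0 \<le> \<delta>" "\<delta> \<le> 1" "real (prime_count_ap x q b) \<le> \<delta> * x / real (totient (nat q))"
      and u_def: "u = (LEAST v :: int. real_of_int v > 2 * sqrt x \<and>
            real_of_int v / ln (real_of_int v) \<ge> 10 * \<delta> * x / real_of_int q)"
    have sqrt_x: "sqrt x \<ge> real n0 + 5" using x by (rule real_le_rsqrt)
    have "(5 :: real)\<^sup>2 \<le> (real n0 + 5)\<^sup>2" by (intro power_mono) auto
    hence x4: "x \<ge> 4" using x by simp
    have u: "real_of_int u > 2 * sqrt x" "real_of_int u / ln (real_of_int u) \<ge> 10 * \<delta> * x / real_of_int q"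
      using Least_int_growth[OF _ u_def] x4 by simp_all
    \<comment> \<open>A prime \<open>p > n\<close> satisfies
      \<open>2 * p \<ge> 2 * n + 2 > u > 2 * sqrt x\<close>, so the primes in \<open>(n, 2n]\<close>
      all lie in \<open>(sqrt x, u]\<close>.\<close>
    define n where "n = nat u div 2"
    have n: "int (2 * n) \<le> u" "u \<le> 2 * int n + 1"
      using u(1) sqrt_x unfolding n_def by linarith+
    have "n \<ge> n0" "nat u \<ge> n0" using u(1) sqrt_x unfolding n_def by linarith+
    have n5: "n \<ge> 5" and pc: "pc n \<ge> (2 * real n + 1) / (5 * ln (2 * real n)) + 3"
      using n0[OF \<open>n \<ge> n0\<close>] by auto

    have many: "real (card {p :: nat. prime p \<and> sqrt x < real p \<and> int p \<le> u}) \<ge>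
        real_of_int u / (5 * ln (real_of_int u)) + 2"
    proof -
      have "2 * real n \<le> real_of_int u" "real_of_int u \<le> 2 * real n + 1" using n by linarith+
      hence "real_of_int u / (5 * ln (real_of_int u)) \<le> (2 * real n + 1) / (5 * ln (2 * real n))"
        using n5 by (intro frac_le) auto
      moreover have "{p :: nat. prime p \<and> n < p \<and> p \<le> 2 * n} \<subseteq>
          {p. prime p \<and> sqrt x < real p \<and> int p \<le> u}"
        using u(1) n(2) n(1) by (intro Collect_mono) linarith
      hence "pc n \<le> real (card {p :: nat. prime p \<and> sqrt x < real p \<and> int p \<le> u})"
        unfolding pc_def of_nat_le_iff
        by (rule card_mono[rotated]) (rule finite_subset[of _ "{..nat u}"], auto)
      ultimately show ?thesis using pc by linarith
    qed
    \<comment> \<open>The last index with \<open>q * M + b \<le> x\<close>; rounding down is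
      harmless since the sieve yields a gap of at least \<open>M + 2\<close>.\<close>
    define M where "M = \<lfloor>(x - real_of_int b) / real_of_int q\<rfloor>"
    have qpos: "real_of_int q > 0" using q by simp
    have "real_of_int M \<le> (x - real_of_int b) / real_of_int q" unfolding M_def by simp
    hence M: "real_of_int (q * M + b) \<le> x" using qpos by (simp add: field_simps)
    have "0 \<le> (x - real_of_int b) / real_of_int q" using q qpos by simp
    hence M0: "0 \<le> M" unfolding M_def by (simp only: zero_le_floor)
    have "sqrt x \<le> real_of_int u" using u(1) sqrt_x by linarith
    from covers_progression[OF x4 q(1-4) M \<delta>(1,3) this u(2) many]
    have "M + 2 \<le> jacobsthal (real_of_int u)" using M0 by (rule jacobsthal_ge)
    hence "(x - real_of_int b) / real_of_int q \<le> real_of_int (jacobsthal (real_of_int u))"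
      unfolding M_def by linarith
    moreover have "jacobsthal (real_of_int u) \<le> prime_gap (exp (2 * real_of_int u))"
    proof (rule jacobsthal_le_prime_gap)
      show "u \<ge> 2" using u(1) sqrt_x by linarith
      \<comment> \<open>A prime in \<open>(m, 2m]\<close> exceeds three times the primorial and is
        at most \<open>6 * 4 ^ u \<le> exp (2 * u)\<close>.\<close>
      define m :: nat where "m = 3 * 4 ^ nat u"
      have "nat u < 2 ^ nat u" by (rule less_exp)
      also have "\<dots> \<le> 4 ^ nat u" by (intro power_mono) auto
      finally have "m \<ge> n0" using \<open>nat u \<ge> n0\<close> unfolding m_def by linarith
      hence m: "m \<ge> 5" "pc m \<ge> (2 * real m + 1) / (5 * ln (2 * real m)) + 3"
        using n0[of m] by auto
      moreover have "(2 * real m + 1) / (5 * ln (2 * real m)) \<ge> 0" using m(1) by simp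
      ultimately have "pc m > 0" by linarith
      hence "{p :: nat. prime p \<and> m < p \<and> p \<le> 2 * m} \<noteq> {}" unfolding pc_def by force
      then obtain p :: nat where p: "prime p" "m < p" "p \<le> 2 * m" by blast
      have "3 * primorial (nat u) \<le> m" unfolding m_def using primorial_le by simp
      moreover have "real p \<le> exp (2 * real_of_int u)"
      proof -
        have "real p \<le> real (2 * m)" using p(3) by (simp only: of_nat_le_iff)
        also have "\<dots> = 6 * 4 ^ nat u" by (simp add: m_def)
        also have "\<dots> \<le> exp (2 * real (nat u))" using n0[OF \<open>nat u \<ge> n0\<close>] by blast
        also have "real (nat u) = real_of_int u" using \<open>u \<ge> 2\<close> by simp
        finally show ?thesis .
      qed
      ultimately show "\<exists>p. prime p \<and> 3 * primorial (nat u) < p \<and> real p \<le> exp (2 * real_of_int u)"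
        using p by (intro exI[of _ p]) auto
    qed
    ultimately show "prime_gap (exp (2 * real_of_int u)) \<ge> jacobsthal (real_of_int u) \<and>
        real_of_int (jacobsthal (real_of_int u)) \<ge> (x - real_of_int b) / real_of_int q" by simp
  qed
qed

end
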